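(* Let $\overrightarrow{G}$ be a finite directed graph with no connected component of order less than $3$, and let $\Gamma$ be a finite Abelian group such that $|\Gamma|\geq 4|V(\overrightarrow{G})|$. Then $\overrightarrow{G}$ is realizable in $\Gamma$.
   Context: Directed graphs have vertex set $V(\overrightarrow{G})$ and arc set $E(\overrightarrow{G})$; an arc $xy$ is directed from its tail $x$ to its head $y$. Connected components of $\overrightarrow{G}$ are those of the underlying undirected graph (weak components); the order of a component is its number of vertices. Groups are written additively with identity $0$. Given a mapping $\psi : E(\overrightarrow{G}) \to \Gamma$ to an Abelian group $\Gamma$, define $\varphi_\psi : V(\overrightarrow{G}) \to \Gamma$ by $$\varphi_\psi(x) = \sum_{y:\, yx\in E(\overrightarrow{G})}\psi(yx) - \sum_{y:\, xy\in E(\overrightarrow{G})}\psi(xy).$$ The directed graph $\overrightarrow{G}$ is called realizable in $\Gamma$ if there exists $\psi : E(\overrightarrow{G})\to\Gamma$ such that $\varphi_\psi$ is injective. *)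

theory Defs
  imports "HOL-Library.Cardinality" "Graph_Theory.Digraph_Component"
begin

text \<open>
  Directed graphs are \<open>pair_fin_digraph\<close>s: arcs are ordered pairs (tail, head), so there are no
  parallel arcs, while opposite arcs and loops are allowed. The usual loopless setting
  (\<open>pair_digraph\<close>) is a special case; a loop at \<open>x\<close> contributes \<open>\<psi> (x, x) - \<psi> (x, x) = 0\<close>
  to \<open>arc_excess G \<psi> x\<close>.
\<close>

text \<open>
  The library's undirected graphs are symmetric digraphs, and \<open>mk_symmetric\<close> is the
  underlying undirected graph; strong components of a symmetric digraph are its ordinary
  connected components.
\<close>

definition weak_components :: "'a pair_pre_digraph \<Rightarrow> ('a, 'a \<times> 'a) pre_digraph set" where
  "weak_components G = pre_digraph.sccs (with_proj (mk_symmetric (with_proj G)))"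

text \<open>
  This is \<open>\<phi>\<^sub>\<psi>\<close>. Here \<open>\<psi>\<close> is a total function on pairs, but only its values on arcs matter.
\<close>

definition arc_excess ::
  "'a pair_pre_digraph \<Rightarrow> ('a \<times> 'a \<Rightarrow> 'g) \<Rightarrow> 'a \<Rightarrow> 'g::ab_group_add" where
  "arc_excess G \<psi> x =
     (\<Sum>y\<in>{y. (y, x) \<in> parcs G}. \<psi> (y, x)) - (\<Sum>y\<in>{y. (x, y) \<in> parcs G}. \<psi> (x, y))"

definition realizable_in :: "'a pair_pre_digraph \<Rightarrow> 'g::ab_group_add itself \<Rightarrow> bool" where
  "realizable_in G \<Gamma> \<longleftrightarrow> (\<exists>\<psi> :: 'a \<times> 'a \<Rightarrow> 'g. inj_on (arc_excess G \<psi>) (pverts G))"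

end

theory Submission
  imports Defs
begin

text \<open>
  Pushing a value along a walk shows that a function on the vertices is of the form
  \<open>\<phi>\<^sub>\<psi>\<close> as soon as it sums to zero on every weak component. It remains to find disjoint
  zero-sum subsets of \<open>\<Gamma>\<close> whose sizes are the component orders, and this can be done greedily:
  a set of size \<open>m\<close> is made of \<open>m - 2\<close> fresh elements with sum \<open>- c \<noteq> 0\<close> and of a fresh pair
  \<open>{x, c - x}\<close>. Since \<open>c \<noteq> 0\<close>, at most half of the group satisfies \<open>x + x = c\<close>, and at most
  another \<open>2 |V| - 4 < |\<Gamma>| / 2\<close> elements \<open>x\<close> are excluded because \<open>x\<close> or \<open>c - x\<close> is in use.
\<close>

section \<open>Zero-sum subsets of a finite Abelian group\<close>

text \<open>Translating the solution set by a fixed solution \<open>a\<close> gives elements that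
  double to \<open>0\<close>. Since \<open>c\<close> is nonzero, the translate is disjoint from the
  original set and has the same size.\<close>

lemma card_halves_le:
  fixes c :: "'g::{finite, ab_group_add}"
  assumes "c \<noteq> 0"
  shows "2 * card {x. x + x = c} \<le> CARD('g)"
proof (cases "{x. x + x = c} = {}")
  case False
  then obtain a where a: "a + a = c" by blast
  define F where "F = {x. x + x = c}"
  define F0 where "F0 = (\<lambda>x. x - a) ` F"
  have "x \<notin> F0" if "x \<in> F" for x
  proof
    assume "x \<in> F0"
    then have "(x + x) + (a + a) = c"
      by (auto simp: F_def F0_def algebra_simps)
    with that a assms show False by (simp add: F_def)
  qed
  then have "F \<inter> F0 = {}" by blast
  then have "card F + card F0 = card (F \<union> F0)"
    by (simp add: card_Un_disjoint)
  also have "\<dots> \<le> CARD('g)" by (simp add: card_mono)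
  finally have "card F + card F0 \<le> CARD('g)" .
  moreover have "card F0 = card F" by (simp add: F0_def card_image inj_on_def)
  ultimately show ?thesis by (simp add: F_def)
next
  case True
  then show ?thesis by (simp only: card.empty)
qed

text \<open>With \<open>y = c - x\<close>, the bad \<open>x\<close> are at most half of the group
  plus two sets of size at most \<open>card W\<close>, hence not the whole group.\<close>

lemma ex_distinct_pair_sum:
  fixes c :: "'g::{finite, ab_group_add}"
  assumes "c \<noteq> 0" and "4 * card W < CARD('g)"
  shows "\<exists>x y. x \<noteq> y \<and> x + y = c \<and> x \<notin> W \<and> y \<notin> W"
proof -
  let ?B = "{x. x + x = c} \<union> W \<union> (\<lambda>w. c - w) ` W"
  have "card ?B \<le> card {x. x + x = c} + card W + card ((\<lambda>w. c - w) ` W)"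
    by (meson add_le_mono1 card_Un_le order_trans)
  moreover have "card ((\<lambda>w. c - w) ` W) \<le> card W" by (simp add: card_image_le)
  ultimately have "card ?B < CARD('g)"
    using card_halves_le[OF assms(1)] assms(2) by linarith
  then have "?B \<noteq> UNIV" by (metis less_irrefl)
  then obtain x where x: "x \<notin> ?B" by blast
  have "c - x \<notin> W"
  proof
    assume "c - x \<in> W"
    then have "c - (c - x) \<in> (\<lambda>w. c - w) ` W" by (rule imageI)
    with x show False by simp
  qed
  moreover have "x \<noteq> c - x"
  proof
    assume "x = c - x"
    then have "x + x = c" by (simp add: eq_diff_eq)
    with x show False by simp
  qed
  ultimately show ?thesis using x by (intro exI[of _ x] exI[of _ "c - x"]) simp
qed

lemma ex_zero_sum_subset:
  fixes U :: "'g::{finite, ab_group_add} set"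
  assumes m: "3 \<le> m" and le: "4 * (card U + m) \<le> CARD('g)"
  shows "\<exists>S. S \<inter> U = {} \<and> card S = m \<and> \<Sum>S = 0"
proof -
  obtain k where k: "m = 3 + k" using m le_Suc_ex by blast
  have "card U + card (- U) = CARD('g)"
    using card_Un_disjoint[of U "- U"] by simp
  with le k have "k \<le> card (- U)" by simp
  then obtain A where A: "A \<subseteq> - U" "card A = k"
    by (meson obtain_subset_with_card_n)
  have "card (insert (- \<Sum>A) (U \<union> A)) \<le> Suc (card U + card A)"
    using card_Un_le[of U A] by (simp add: card_insert_if)
  also have "\<dots> < CARD('g)" using le k A(2) by simp
  \<comment> \<open>Avoiding \<open>- \<Sum>A\<close> makes the sum of \<open>insert a A\<close>
    nonzero, which the final pair requires.\<close>
  finally have "insert (- \<Sum>A) (U \<union> A) \<noteq> UNIV" by (metis less_irrefl)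
  then obtain a where a: "a \<noteq> - \<Sum>A" "a \<notin> U" "a \<notin> A" by blast
  define B where "B = insert a A"
  have c: "- \<Sum>B \<noteq> 0" using a by (simp add: B_def eq_neg_iff_add_eq_0 neg_eq_iff_add_eq_0)
  have cardB: "card B = k + 1" using a(3) A(2) by (simp add: B_def)
  have "card (U \<union> B) \<le> card U + card B" by (rule card_Un_le)
  \<comment> \<open>\<open>B\<close> has only \<open>m - 2\<close> elements, which turns the bound
    on \<open>card U + m\<close> into a strict one.\<close>
  then have "4 * card (U \<union> B) < CARD('g)" using le k cardB by simp
  from ex_distinct_pair_sum[OF c this] obtain x y where
    xy: "x \<noteq> y" "x + y = - \<Sum>B" "x \<notin> U \<union> B" "y \<notin> U \<union> B" by blast
  let ?S = "insert x (insert y B)"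
  have "?S \<inter> U = {}" using A(1) a(2) xy by (auto simp: B_def)
  moreover have "card ?S = m" using xy cardB k by simp
  moreover have "\<Sum>?S = (x + y) + \<Sum>B" using xy(1,3,4) by (simp add: add.assoc)
  then have "\<Sum>?S = 0" by (simp add: xy(2))
  ultimately show ?thesis by blast
qed

text \<open>Induction on the number of parts. The values already used play the role of
  \<open>U\<close>; by injectivity there are as many as vertices covered so far, so the global bound
  gives the bound needed for each new part.\<close>

lemma ex_inj_zero_sum_on_parts:
  assumes "finite P" and "disjoint P" and "\<And>C. C \<in> P \<Longrightarrow> finite C \<and> 3 \<le> card C"
    and "4 * card (\<Union>P) \<le> CARD('g::{finite, ab_group_add})"
  shows "\<exists>f :: 'a \<Rightarrow> 'g. inj_on f (\<Union>P) \<and> (\<forall>C\<in>P. sum f C = 0)"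
  using assms
proof (induction P rule: finite_induct)
  case empty
  then show ?case by simp
next
  case (insert C P)
  have disj: "C \<inter> \<Union>P = {}"
    using insert.prems(1) insert.hyps(2) by (auto simp: disjoint_def)
  have fin: "finite C" "3 \<le> card C" "finite (\<Union>P)"
    using insert.prems(2) insert.hyps(1) by auto
  have card: "card (\<Union>(insert C P)) = card C + card (\<Union>P)"
    using disj fin by (simp add: card_Un_disjoint)
  have "\<exists>f :: 'a \<Rightarrow> 'g. inj_on f (\<Union>P) \<and> (\<forall>C\<in>P. sum f C = 0)"
    using insert.prems card by (intro insert.IH) (auto simp: disjoint_def)
  then obtain f :: "'a \<Rightarrow> 'g" where f: "inj_on f (\<Union>P)" "\<And>D. D \<in> P \<Longrightarrow> sum f D = 0"
    by blast
  have "4 * (card (f ` \<Union>P) + card C) \<le> CARD('g)"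
    using insert.prems(3) card f(1) by (simp add: card_image)
  from ex_zero_sum_subset[OF fin(2) this] obtain S where
    S: "S \<inter> f ` \<Union>P = {}" "card S = card C" "\<Sum>S = 0" by blast
  obtain h where h: "bij_betw h C S"
    using S(2) fin(1) by (metis finite finite_same_card_bij)
  let ?f = "\<lambda>x. if x \<in> C then h x else f x"
  have old: "?f x = f x" if "x \<in> \<Union>P" for x using that disj by auto
  have "inj_on ?f C" "?f ` C = S"
    using h by (auto simp: bij_betw_def inj_on_def)
  moreover have "inj_on ?f (\<Union>P)"
    using f(1) inj_on_cong[of "\<Union>P" ?f f, OF old] by blast
  moreover have "?f ` \<Union>P = f ` \<Union>P" by (rule image_cong[OF refl old])
  ultimately have "inj_on ?f (C \<union> \<Union>P)" using S(1) by (auto simp: inj_on_Un)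
  moreover have "sum ?f C = 0"
    using h S(3) sum.reindex_bij_betw[of h C S "\<lambda>s. s"] by simp
  moreover have "sum ?f D = 0" if "D \<in> P" for D
  proof -
    have "sum ?f D = sum f D" using old that by (intro sum.cong refl) blast
    then show ?thesis using f(2)[OF that] by simp
  qed
  ultimately show ?case by (intro exI[of _ ?f]) simp
qed

section \<open>Excess functions and transport along walks\<close>

lemma arc_excess_add:
  "arc_excess G (\<lambda>e. \<psi> e + \<chi> e) x = arc_excess G \<psi> x + arc_excess G \<chi> x"
  by (simp add: arc_excess_def sum.distrib)

lemma arc_excess_sum:
  "arc_excess G (\<lambda>e. \<Sum>i\<in>I. \<psi> i e) x = (\<Sum>i\<in>I. arc_excess G (\<psi> i) x)"
  unfolding arc_excess_def sum_subtractf by (simp add: sum.swap[of _ I])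

context pair_fin_digraph
begin

lemma arc_excess_single_arc:
  assumes "(a, b) \<in> parcs G"
  shows "arc_excess G (\<lambda>e. if e = (a, b) then g else 0) x =
    (if x = b then g else 0) - (if x = a then g else 0)"
proof -
  \<comment> \<open>A sum over an infinite set would be \<open>0\<close> by default; finiteness lets
    it pick out the one nonzero term. If \<open>a = b\<close>, the two contributions cancel.\<close>
  have "finite {y. (y, x) \<in> parcs G}" "finite {y. (x, y) \<in> parcs G}"
    using finite_subset[of "{y. (y, x) \<in> parcs G}" "pverts G"]
      finite_subset[of "{y. (x, y) \<in> parcs G}" "pverts G"]
      pair_finite_verts in_arcsD1 in_arcsD2 by blast+
  then show ?thesis using assms by (auto simp: arc_excess_def)
qed

text \<open>Induction along the walk: adding the labelling of the next step cancels the contribution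
  at the intermediate vertex.\<close>

lemma ex_arc_excess_transport:
  fixes g :: "'g::ab_group_add"
  assumes "u \<rightarrow>\<^sup>*\<^bsub>mk_symmetric G\<^esub> v"
  shows "\<exists>\<psi>. \<forall>x. arc_excess G \<psi> x = (if x = v then g else 0) - (if x = u then g else 0)"
proof -
  interpret S: pair_wf_digraph "mk_symmetric G" ..
  from assms show ?thesis
  proof (induction rule: S.reachable_induct)
    case base
    show ?case by (intro exI[of _ "\<lambda>_. 0"]) (simp add: arc_excess_def)
  next
    case (step a b)
    then obtain \<psi> where
      \<psi>: "\<And>x. arc_excess G \<psi> x = (if x = a then g else 0) - (if x = u then g else 0)" by blast
    from step have "(a, b) \<in> parcs G \<or> (b, a) \<in> parcs G"
      by (auto simp: parcs_mk_symmetric)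
    then obtain \<chi> where
      "\<And>x. arc_excess G \<chi> x = (if x = b then g else 0) - (if x = a then g else 0)"
    proof
      assume ba: "(b, a) \<in> parcs G"
      show thesis
        \<comment> \<open>This arc is traversed against its direction, so it carries
          \<open>- g\<close>.\<close>
        by (rule that[of "\<lambda>e. if e = (b, a) then - g else 0"])
          (simp add: arc_excess_single_arc[OF ba])
    qed (use arc_excess_single_arc that in blast)
    with \<psi> have "arc_excess G (\<lambda>e. \<psi> e + \<chi> e) x =
        (if x = b then g else 0) - (if x = u then g else 0)" for x
      by (simp add: arc_excess_add)
    then show ?case by blast
  qed
qed

section \<open>Weak components and prescribed excess\<close>

lemma verts_weak_components:
  "verts ` weak_components G = pre_digraph.scc_of (mk_symmetric G) ` pverts G"
proof -
  interpret S: pair_wf_digraph "mk_symmetric G" ..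
  show ?thesis
    using S.sccs_verts_conv S.sccs_verts_conv_scc_of by (simp add: weak_components_def)
qed

lemma disjoint_verts_weak_components: "disjoint (verts ` weak_components G)"
proof -
  interpret S: pair_wf_digraph "mk_symmetric G" ..
  show ?thesis
    unfolding disjoint_def weak_components_def S.sccs_verts_conv[symmetric]
    using S.sccs_verts_disjoint by blast
qed

lemma Union_verts_weak_components: "\<Union>(verts ` weak_components G) = pverts G"
proof -
  interpret S: pair_wf_digraph "mk_symmetric G" ..
  show ?thesis
    unfolding verts_weak_components
    using S.in_scc_of_self S.scc_of_in_sccs_verts S.sccs_verts_subsets by fastforce
qed

text \<open>Each component gets a root, from which \<open>f x\<close> is moved to every vertex
  \<open>x\<close>. In total a root loses the sum of \<open>f\<close> over its component, which is
  zero.\<close>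

lemma ex_arc_excess_eq:
  fixes f :: "'a \<Rightarrow> 'g::ab_group_add"
  assumes zero: "\<And>C. C \<in> weak_components G \<Longrightarrow> sum f (verts C) = 0"
  shows "\<exists>\<psi>. \<forall>x\<in>pverts G. arc_excess G \<psi> x = f x"
proof -
  interpret S: pair_wf_digraph "mk_symmetric G" ..
  \<comment> \<open>The choice depends only on the set \<open>S.scc_of x\<close>, so all vertices of
    a component share one root.\<close>
  define r where "r x = (SOME y. y \<in> S.scc_of x)" for x
  have r: "r x \<in> S.scc_of x" if "x \<in> pverts G" for x
    unfolding r_def using S.in_scc_of_self[of x] that by (intro someI[of "\<lambda>y. y \<in> _"]) simp
  have "\<exists>\<psi>. \<forall>v. arc_excess G \<psi> v = (if v = x then f x else 0) - (if v = r x then f x else 0)"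
    if "x \<in> pverts G" for x
    using r[OF that] by (intro ex_arc_excess_transport) (simp add: S.scc_of_def)
  then obtain \<psi> where \<psi>: "\<And>x v. x \<in> pverts G \<Longrightarrow>
      arc_excess G (\<psi> x) v = (if v = x then f x else 0) - (if v = r x then f x else 0)"
    by metis
  have "arc_excess G (\<lambda>e. \<Sum>x\<in>pverts G. \<psi> x e) v = f v" if v: "v \<in> pverts G" for v
  proof -
    \<comment> \<open>This is the total amount taken out of \<open>v\<close>. If \<open>v\<close> is
      a root, it is the sum of \<open>f\<close> over the component of \<open>v\<close>; otherwise no
      vertex draws from \<open>v\<close>.\<close>
    have "(\<Sum>x\<in>pverts G. if v = r x then f x else 0) = sum f {x \<in> pverts G. r x = v}"
      using pair_finite_verts by (simp add: sum.inter_filter eq_commute)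
    also have "\<dots> = 0"
    proof (cases "r v = v")
      case True
      have "x \<in> S.scc_of v" if "x \<in> pverts G" "r x = v" for x
        using r[OF that(1)] that(2) by (simp add: S.scc_of_def)
      moreover have "x \<in> pverts G \<and> r x = v" if "x \<in> S.scc_of v" for x
      proof -
        have "S.scc_of x = S.scc_of v" using that by (rule S.scc_of_eq)
        then have "r x = v" using True by (simp add: r_def)
        moreover have "x \<in> pverts G"
          using that by (auto simp: S.scc_of_def dest: S.reachable_in_verts)
        ultimately show ?thesis by simp
      qed
      ultimately have "{x \<in> pverts G. r x = v} = S.scc_of v" by blast
      moreover have "S.scc_of v \<in> verts ` weak_components G"
        using v by (simp add: verts_weak_components)
      ultimately show ?thesis using zero by auto
    next
      case False
      have "r x \<noteq> v" if "x \<in> pverts G" for x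
      proof
        assume "r x = v"
        with r[OF that] have "v \<in> S.scc_of x" by simp
        then have "S.scc_of v = S.scc_of x" by (rule S.scc_of_eq)
        then have "r v = r x" by (simp add: r_def)
        with \<open>r x = v\<close> False show False by simp
      qed
      then have "{x \<in> pverts G. r x = v} = {}" by blast
      then show ?thesis by (simp only: sum.empty)
    qed
    finally show ?thesis
      using v pair_finite_verts by (simp add: arc_excess_sum \<psi> sum_subtractf)
  qed
  then show ?thesis by blast
qed

end

theorem theorem2p6:
  fixes G :: "'a pair_pre_digraph"
  assumes "pair_fin_digraph G"
    and "\<not> (\<exists>C\<in>weak_components G. card (verts C) < 3)"
    and "CARD('g::{finite, ab_group_add}) \<ge> 4 * card (pverts G)"
  shows "realizable_in G TYPE('g)"
proof -
  interpret pair_fin_digraph G by fact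
  let ?P = "verts ` weak_components G"
  have "finite ?P" using pair_finite_verts by (simp add: verts_weak_components)
  moreover have "finite C \<and> 3 \<le> card C" if "C \<in> ?P" for C
    using that assms(2) pair_finite_verts Union_verts_weak_components
    by (metis Union_upper finite_subset imageE not_less)
  \<comment> \<open>The components partition \<open>pverts G\<close>, so the assumed bound on the
    group is the one needed for the parts.\<close>
  ultimately obtain f :: "'a \<Rightarrow> 'g" where
    f: "inj_on f (pverts G)" "\<And>C. C \<in> ?P \<Longrightarrow> sum f C = 0"
    using ex_inj_zero_sum_on_parts[of ?P, where 'g = 'g] disjoint_verts_weak_components assms(3)
    unfolding Union_verts_weak_components by blast
  from f(2) obtain \<psi> where "\<forall>x\<in>pverts G. arc_excess G \<psi> x = f x"
    using ex_arc_excess_eq[of f] by blast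
  then have "inj_on (arc_excess G \<psi>) (pverts G)"
    using f(1) by (simp cong: inj_on_cong)
  then show ?thesis unfolding realizable_in_def by blast
qed

end
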